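(* Let $g>0$, $H>0$ and $U\in\mathbb{R}$ with $U^2<gH$ (sub-critical flow, so that $\lambda_1>0$ and $\lambda_2<0$), let $\alpha\ge 0$, and let $\gamma_0,\gamma_1\in\mathbb{R}$ satisfy $\gamma_0^2\le-\lambda_2/\lambda_1$ and $\gamma_1^2\le-\lambda_1/\lambda_2$. Consider the semi-discrete finite volume approximation $$(I_2\otimes P)\frac{d\bar{\mathbf{q}}}{dt}+(M\otimes Q)\bar{\mathbf{q}}-\frac{\alpha}{2}(I_2\otimes A)\bar{\mathbf{q}}=\mathrm{SAT},\qquad t\ge 0,$$ with the penalty term (homogeneous boundary data) $$\mathrm{SAT}=-\frac12\left(W^{-1}SW\otimes I_{N+1}\right)\begin{bmatrix}\tau_{01}H\,\mathbf{e}_0\left(\bar w_1-\gamma_0\bar w_2\right)\big|_{i=0}+\tau_{N1}H\,\mathbf{e}_N\left(\bar w_2-\gamma_1\bar w_1\right)\big|_{i=N}\\ \tau_{02}\,g\,\mathbf{e}_0\left(\bar w_1-\gamma_0\bar w_2\right)\big|_{i=0}+\tau_{N2}\,g\,\mathbf{e}_N\left(\bar w_2-\gamma_1\bar w_1\right)\big|_{i=N}\end{bmatrix}.$$ If the penalty parameters are chosen as $$\tau_{01}=\lambda_1,\quad\tau_{02}=\gamma_0\lambda_1,\quad\tau_{N2}=-\lambda_2,\quad\tau_{N1}=-\gamma_1\lambda_2,$$ then every solution $\bar{\mathbf{q}}$ satisfies $$\frac12\frac{d}{dt}\Vert\bar{\mathbf{q}}\Vert_{WP}^2\le 0\qquad\text{for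 all }t\ge 0.$$
   Context: Continuous data: $M=\begin{bmatrix}U&H\\ g&U\end{bmatrix}$, $W=\begin{bmatrix}g&0\\0&H\end{bmatrix}$, $$\lambda_{1}=\frac{1}{2gH}\left(U(g+H)+\sqrt{U^2(g+H)^2+4gH(gH-U^2)}\right),$$ $$\lambda_{2}=\frac{1}{2gH}\left(U(g+H)-\sqrt{U^2(g+H)^2+4gH(gH-U^2)}\right),$$ $$S=\begin{bmatrix}\frac1c\left(\lambda_1-\frac Ug\right)&\frac1d\left(\lambda_2-\frac Ug\right)\\ \frac1c&\frac1d\end{bmatrix},\quad c=\sqrt{\left(\lambda_1-\tfrac Ug\right)^2+1},\quad d=\sqrt{\left(\lambda_2-\tfrac Ug\right)^2+1}.$$ Grid: $N\ge1$, nodes $0=x_0<x_1<\dots<x_N=1$, $\Delta x_i=x_i-x_{i-1}>0$, and control cell lengths $|I_0|=\Delta x_1/2$, $|I_i|=(\Delta x_i+\Delta x_{i+1})/2$ for $1\le i\le N-1$, $|I_N|=\Delta x_N/2$. Matrices of size $(N+1)\times(N+1)$ (indices $0,\dots,N$): $P=\mathrm{diag}(|I_0|,\dots,|I_N|)$. $Q$ has first row $(-\frac12,\frac12,0,\dots,0)$, last row $(0,\dots,0,-\frac12,\frac12)$, and for $1\le i\le N-1$ its row $i$ has entries $Q_{i,i-1}=-\frac12$, $Q_{i,i+1}=\frac12$ and zeros elsewhere. $A$ has first row $(-1,1,0,\dots,0)$, last row $(0,\dots,0,1,-1)$, and for $1\le i\le N-1$ its row $i$ has entries $A_{i,i-1}=1$,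 $A_{i,i}=-2$, $A_{i,i+1}=1$ and zeros elsewhere. The unknown $\bar{\mathbf{q}}(t)\in\mathbb{R}^{2(N+1)}$ collects the cell averages $\bar{\mathbf{q}}_i=[\bar h_i,\bar u_i]^\top$, ordered compatibly with the Kronecker products, i.e. $\bar{\mathbf{q}}=(\bar h_0,\dots,\bar h_N,\bar u_0,\dots,\bar u_N)^\top$. At each node $i$, $[\bar w_1,\bar w_2]^\top|_i=S^\top\bar{\mathbf{q}}_i$. $\mathbf{e}_0=(1,0,\dots,0)^\top$ and $\mathbf{e}_N=(0,\dots,0,1)^\top$ in $\mathbb{R}^{N+1}$; $I_k$ is the $k\times k$ identity and $\otimes$ the Kronecker product. The discrete norm is $\Vert\bar{\mathbf{q}}\Vert_{WP}^2=\bar{\mathbf{q}}^\top(W\otimes P)\bar{\mathbf{q}}$. *)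

theory Defs
  imports Complex_Main "Jordan_Normal_Form.Gauss_Jordan_Elimination"
begin

subsection \<open>Kronecker product and derivatives of vector-valued curves\<close>

definition kron :: "real mat \<Rightarrow> real mat \<Rightarrow> real mat" where
  "kron A B = mat (dim_row A * dim_row B) (dim_col A * dim_col B)
     (\<lambda>(i, j). A $$ (i div dim_row B, j div dim_col B) * B $$ (i mod dim_row B, j mod dim_col B))"

text \<open>The type \<open>real vec\<close> carries no topology, so differentiability is entrywise.\<close>

definition has_vec_derivative :: "(real \<Rightarrow> real vec) \<Rightarrow> real vec \<Rightarrow> real filter \<Rightarrow> bool" where
  "has_vec_derivative q v F \<longleftrightarrow>
     (\<forall>i < dim_vec v. ((\<lambda>t. q t $ i) has_real_derivative v $ i) F)"

subsection \<open>Continuous data\<close>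

definition M_mat :: "real \<Rightarrow> real \<Rightarrow> real \<Rightarrow> real mat" where
  "M_mat g H U = mat_of_rows_list 2 [[U, H], [g, U]]"

definition W_mat :: "real \<Rightarrow> real \<Rightarrow> real mat" where
  "W_mat g H = mat_of_rows_list 2 [[g, 0], [0, H]]"

definition lambda1 :: "real \<Rightarrow> real \<Rightarrow> real \<Rightarrow> real" where
  "lambda1 g H U = 1 / (2 * g * H) *
     (U * (g + H) + sqrt (U^2 * (g + H)^2 + 4 * g * H * (g * H - U^2)))"

definition lambda2 :: "real \<Rightarrow> real \<Rightarrow> real \<Rightarrow> real" where
  "lambda2 g H U = 1 / (2 * g * H) *
     (U * (g + H) - sqrt (U^2 * (g + H)^2 + 4 * g * H * (g * H - U^2)))"

definition S_mat :: "real \<Rightarrow> real \<Rightarrow> real \<Rightarrow> real mat" where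
  "S_mat g H U =
     (let c = sqrt ((lambda1 g H U - U / g)^2 + 1);
          d = sqrt ((lambda2 g H U - U / g)^2 + 1)
      in mat_of_rows_list 2
           [[1 / c * (lambda1 g H U - U / g), 1 / d * (lambda2 g H U - U / g)],
            [1 / c, 1 / d]])"

subsection \<open>Grid and discrete operators\<close>

definition is_grid :: "nat \<Rightarrow> (nat \<Rightarrow> real) \<Rightarrow> bool" where
  "is_grid N x \<longleftrightarrow> x 0 = 0 \<and> x N = 1 \<and> (\<forall>i\<in>{1..N}. x (i - 1) < x i)"

definition spacing :: "(nat \<Rightarrow> real) \<Rightarrow> nat \<Rightarrow> real" where
  "spacing x i = x i - x (i - 1)"

definition cell_length :: "nat \<Rightarrow> (nat \<Rightarrow> real) \<Rightarrow> nat \<Rightarrow> real" where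
  "cell_length N x i =
     (if i = 0 then spacing x 1 / 2
      else if i = N then spacing x N / 2
      else (spacing x i + spacing x (i + 1)) / 2)"

definition P_mat :: "nat \<Rightarrow> (nat \<Rightarrow> real) \<Rightarrow> real mat" where
  "P_mat N x = mat_diag (N + 1) (cell_length N x)"

definition Q_mat :: "nat \<Rightarrow> real mat" where
  "Q_mat N = mat (N + 1) (N + 1) (\<lambda>(i, j).
     if i = 0 then (if j = 0 then - 1/2 else if j = 1 then 1/2 else 0)
     else if i = N then (if j = N - 1 then - 1/2 else if j = N then 1/2 else 0)
     else (if j = i - 1 then - 1/2 else if j = i + 1 then 1/2 else 0))"

definition A_mat :: "nat \<Rightarrow> real mat" where
  "A_mat N = mat (N + 1) (N + 1) (\<lambda>(i, j).
     if i = 0 then (if j = 0 then - 1 else if j = 1 then 1 else 0)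
     else if i = N then (if j = N - 1 then 1 else if j = N then - 1 else 0)
     else (if j = i - 1 then 1 else if j = i then - 2 else if j = i + 1 then 1 else 0))"

subsection \<open>The semi-discrete scheme\<close>

text \<open>A state is \<open>(h\<^sub>0, \<dots>, h\<^sub>N, u\<^sub>0, \<dots>, u\<^sub>N)\<close>, so the cell average at node \<open>i\<close> is
  \<open>(q\<^sub>i, q\<^bsub>N+1+i\<^esub>)\<close>.\<close>

definition cell_avg :: "nat \<Rightarrow> real vec \<Rightarrow> nat \<Rightarrow> real vec" where
  "cell_avg N q i = vec_of_list [q $ i, q $ (N + 1 + i)]"

definition w1 :: "real \<Rightarrow> real \<Rightarrow> real \<Rightarrow> nat \<Rightarrow> real vec \<Rightarrow> nat \<Rightarrow> real" where
  "w1 g H U N q i = ((S_mat g H U)\<^sup>T *\<^sub>v cell_avg N q i) $ 0"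

definition w2 :: "real \<Rightarrow> real \<Rightarrow> real \<Rightarrow> nat \<Rightarrow> real vec \<Rightarrow> nat \<Rightarrow> real" where
  "w2 g H U N q i = ((S_mat g H U)\<^sup>T *\<^sub>v cell_avg N q i) $ 1"

text \<open>\<open>W_mat g H\<close> is invertible for nonzero \<open>g\<close> and \<open>H\<close>, so \<open>the (mat_inverse _)\<close> is its
  inverse there.\<close>

definition SAT ::
  "real \<Rightarrow> real \<Rightarrow> real \<Rightarrow> nat \<Rightarrow> real \<Rightarrow> real \<Rightarrow> real \<Rightarrow> real \<Rightarrow> real \<Rightarrow> real \<Rightarrow> real vec \<Rightarrow> real vec"
where
  "SAT g H U N \<gamma>0 \<gamma>1 \<tau>01 \<tau>02 \<tau>N1 \<tau>N2 q =
     (let e0 = unit_vec (N + 1) 0;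
          eN = unit_vec (N + 1) N;
          b0 = w1 g H U N q 0 - \<gamma>0 * w2 g H U N q 0;
          bN = w2 g H U N q N - \<gamma>1 * w1 g H U N q N
      in (- 1/2) \<cdot>\<^sub>v
           (kron (the (mat_inverse (W_mat g H)) * S_mat g H U * W_mat g H) (1\<^sub>m (N + 1)) *\<^sub>v
             (((\<tau>01 * H * b0) \<cdot>\<^sub>v e0 + (\<tau>N1 * H * bN) \<cdot>\<^sub>v eN) @\<^sub>v
              ((\<tau>02 * g * b0) \<cdot>\<^sub>v e0 + (\<tau>N2 * g * bN) \<cdot>\<^sub>v eN))))"

text \<open>On \<open>[0, \<infinity>)\<close> the derivative at \<open>t = 0\<close> is one-sided.\<close>

definition is_solution ::
  "real \<Rightarrow> real \<Rightarrow> real \<Rightarrow> real \<Rightarrow> nat \<Rightarrow> (nat \<Rightarrow> real) \<Rightarrow>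
   real \<Rightarrow> real \<Rightarrow> real \<Rightarrow> real \<Rightarrow> real \<Rightarrow> real \<Rightarrow> (real \<Rightarrow> real vec) \<Rightarrow> bool"
where
  "is_solution g H U \<alpha> N x \<gamma>0 \<gamma>1 \<tau>01 \<tau>02 \<tau>N1 \<tau>N2 q \<longleftrightarrow>
     (\<forall>t\<ge>0. q t \<in> carrier_vec (2 * (N + 1)) \<and>
       (\<exists>dq \<in> carrier_vec (2 * (N + 1)).
          has_vec_derivative q dq (at t within {0..}) \<and>
          kron (1\<^sub>m 2) (P_mat N x) *\<^sub>v dq
            + kron (M_mat g H U) (Q_mat N) *\<^sub>v q t
            - (\<alpha> / 2) \<cdot>\<^sub>v (kron (1\<^sub>m 2) (A_mat N) *\<^sub>v q t)
          = SAT g H U N \<gamma>0 \<gamma>1 \<tau>01 \<tau>02 \<tau>N1 \<tau>N2 (q t)))"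

definition WP_norm_sq :: "real \<Rightarrow> real \<Rightarrow> nat \<Rightarrow> (nat \<Rightarrow> real) \<Rightarrow> real vec \<Rightarrow> real" where
  "WP_norm_sq g H N x q = q \<bullet> (kron (W_mat g H) (P_mat N x) *\<^sub>v q)"

end

theory Submission
  imports Defs
begin

text \<open>The energy method: pairing the scheme with \<open>W q\<close>, the \<open>A\<close>-term is dissipative and, since
  \<open>Q + Q\<^sup>T = diag(-1, 0, \<dots>, 0, 1)\<close>, the flux term leaves only the quadratic form of the symmetric
  matrix \<open>W M\<close> at the two end nodes. This matrix is \<open>g H S diag(\<lambda>\<^sub>1, \<lambda>\<^sub>2) S\<^sup>T\<close> with \<open>S\<close> orthogonal, so in
  the variables \<open>w\<close> the boundary terms are diagonal. The penalty cancels the ingoing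
  characteristic at each end, leaving \<open>(\<lambda>\<^sub>2 + \<lambda>\<^sub>1 \<gamma>\<^sub>0\<^sup>2) w\<^sub>2\<^sup>2\<close> on the left and
  \<open>-(\<lambda>\<^sub>1 + \<lambda>\<^sub>2 \<gamma>\<^sub>1\<^sup>2) w\<^sub>1\<^sup>2\<close> on the right (both times \<open>g H / 2\<close>), which are nonpositive.\<close>

section \<open>Kronecker products acting on block vectors\<close>

lemma dim_kron [simp]:
  "dim_row (kron A B) = dim_row A * dim_row B" "dim_col (kron A B) = dim_col A * dim_col B"
  by (simp_all add: kron_def)

text \<open>Writing a column index as \<open>b * dim_col B + j\<close> cuts the long sum into
  consecutive blocks of length \<open>dim_col B\<close>; within a block, \<open>div\<close> and
  \<open>mod\<close> recover \<open>b\<close> and \<open>j\<close>.\<close>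

lemma kron_mult_vec_index:
  assumes a: "a < dim_row A" and i: "i < dim_row B"
    and v: "v \<in> carrier_vec (dim_col A * dim_col B)"
  shows "(kron A B *\<^sub>v v) $ (a * dim_row B + i) =
    (\<Sum>b<dim_col A. A $$ (a, b) * (\<Sum>j<dim_col B. B $$ (i, j) * v $ (b * dim_col B + j)))"
proof -
  let ?m = "dim_row B" and ?n = "dim_col B"
  have lt: "a * ?m + i < dim_row A * ?m"
  proof -
    have "a * ?m + i < Suc a * ?m" using i by simp
    also have "\<dots> \<le> dim_row A * ?m" using a by (intro mult_right_mono) auto
    finally show ?thesis .
  qed
  define f where "f k = A $$ (a, k div ?n) * B $$ (i, k mod ?n) * v $ k" for k
  have "(kron A B *\<^sub>v v) $ (a * ?m + i) = (\<Sum>k<dim_col A * ?n. f k)"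
    using lt i v
    by (auto simp: kron_def scalar_prod_def f_def atLeast0LessThan intro!: sum.cong)
  also have "\<dots> = (\<Sum>b<dim_col A. sum f {b * ?n..<b * ?n + ?n})"
    by (rule sum.nat_group[symmetric])
  also have "\<dots> = (\<Sum>b<dim_col A. \<Sum>j<?n. f (b * ?n + j))"
  proof (rule sum.cong[OF refl])
    fix b
    show "sum f {b * ?n..<b * ?n + ?n} = (\<Sum>j<?n. f (b * ?n + j))"
      using sum.shift_bounds_nat_ivl[of f 0 "b * ?n" ?n]
      by (simp add: add.commute atLeast0LessThan)
  qed
  finally show ?thesis
    by (simp add: f_def sum_distrib_left mult.assoc)
qed

lemma kron_2_mult_vec_index:
  assumes "A \<in> carrier_mat 2 2" "B \<in> carrier_mat n n" "v \<in> carrier_vec (2 * n)" "i < n"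
  shows "(kron A B *\<^sub>v v) $ i =
      A $$ (0, 0) * (\<Sum>j<n. B $$ (i, j) * v $ j) + A $$ (0, 1) * (\<Sum>j<n. B $$ (i, j) * v $ (n + j))"
    and "(kron A B *\<^sub>v v) $ (n + i) =
      A $$ (1, 0) * (\<Sum>j<n. B $$ (i, j) * v $ j) + A $$ (1, 1) * (\<Sum>j<n. B $$ (i, j) * v $ (n + j))"
  using kron_mult_vec_index[of 0 A i B v] kron_mult_vec_index[of 1 A i B v] assms
  by (auto simp: numeral_2_eq_2)

section \<open>Difference stencils and summation by parts\<close>

lemma sum_of_bool_mult:
  fixes f :: "nat \<Rightarrow> real"
  assumes "k < n"
  shows "(\<Sum>j<n. of_bool (j = k) * f j) = f k"
proof -
  have "(\<Sum>j<n. of_bool (j = k) * f j) = (\<Sum>j<n. if j = k then f j else 0)"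
    by (intro sum.cong) auto
  then show ?thesis using assms by simp
qed

text \<open>Clamping the neighbours \<open>i - 1\<close> and \<open>i + 1\<close> to \<open>{0..N}\<close> makes the boundary rows of
  \<open>Q\<close> and \<open>A\<close> instances of the interior stencil.\<close>

lemma Q_mat_apply:
  assumes "N \<ge> 1" "i < N + 1"
  shows "(\<Sum>j<N + 1. Q_mat N $$ (i, j) * v j) = (v (min N (i + 1)) - v (i - 1)) / 2"
proof -
  have "(\<Sum>j<N + 1. Q_mat N $$ (i, j) * v j) =
      (\<Sum>j<N + 1. (of_bool (j = min N (i + 1)) * v j - of_bool (j = i - 1) * v j) / 2)"
    using assms by (intro sum.cong) (auto simp: Q_mat_def min_def)
  also have "\<dots> = (v (min N (i + 1)) - v (i - 1)) / 2"
    using assms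
    by (simp only: sum_divide_distrib[symmetric] sum_subtractf)
       (subst sum_of_bool_mult sum_of_bool_mult, simp_all)+
  finally show ?thesis .
qed

lemma A_mat_apply:
  assumes "N \<ge> 1" "i < N + 1"
  shows "(\<Sum>j<N + 1. A_mat N $$ (i, j) * v j) = v (min N (i + 1)) - 2 * v i + v (i - 1)"
proof -
  have "(\<Sum>j<N + 1. A_mat N $$ (i, j) * v j) =
      (\<Sum>j<N + 1. of_bool (j = min N (i + 1)) * v j - 2 * (of_bool (j = i) * v j)
        + of_bool (j = i - 1) * v j)"
    using assms by (intro sum.cong) (auto simp: A_mat_def min_def)
  also have "\<dots> = v (min N (i + 1)) - 2 * v i + v (i - 1)"
    using assms
    by (simp only: sum_divide_distrib[symmetric] sum_subtractf sum.distrib sum_distrib_left[symmetric])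
       (subst sum_of_bool_mult sum_of_bool_mult, simp_all)+
  finally show ?thesis .
qed

lemma sum_clamped_next:
  fixes f v :: "nat \<Rightarrow> real"
  shows "(\<Sum>i<N + 1. f i * v (min N (i + 1))) = (\<Sum>i<N. f i * v (i + 1)) + f N * v N"
  by (auto intro!: sum.cong)

text \<open>Truncated subtraction gives \<open>0 - 1 = 0\<close>, so the left clamp needs no
  explicit \<open>max\<close>; node 0 is split off and the rest is shifted.\<close>

lemma sum_clamped_prev:
  fixes f v :: "nat \<Rightarrow> real"
  shows "(\<Sum>i<N + 1. f i * v (i - 1)) = f 0 * v 0 + (\<Sum>i<N. f (i + 1) * v i)"
  by (simp add: sum.lessThan_Suc_shift del: sum.lessThan_Suc)

text \<open>Exchanging \<open>f\<close> and \<open>v\<close> swaps the two interior sums, which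
  carry opposite signs. Only the end contributions survive, one half from each product.\<close>

lemma Q_summation_by_parts:
  fixes f v :: "nat \<Rightarrow> real"
  assumes "N \<ge> 1"
  shows "(\<Sum>i<N + 1. f i * (\<Sum>j<N + 1. Q_mat N $$ (i, j) * v j))
       + (\<Sum>i<N + 1. v i * (\<Sum>j<N + 1. Q_mat N $$ (i, j) * f j)) = f N * v N - f 0 * v 0"
proof -
  have eq: "(\<Sum>i<N + 1. f i * (\<Sum>j<N + 1. Q_mat N $$ (i, j) * v j)) =
      ((\<Sum>i<N. f i * v (i + 1)) + f N * v N - (f 0 * v 0 + (\<Sum>i<N. f (i + 1) * v i))) / 2"
    for f v :: "nat \<Rightarrow> real"
  proof -
    have "(\<Sum>i<N + 1. f i * (\<Sum>j<N + 1. Q_mat N $$ (i, j) * v j)) =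
        (\<Sum>i<N + 1. (f i * v (min N (i + 1)) - f i * v (i - 1)) / 2)"
      using assms by (intro sum.cong refl, subst Q_mat_apply) (auto simp: right_diff_distrib)
    then show ?thesis
      by (simp only: sum_divide_distrib[symmetric] sum_subtractf sum_clamped_next sum_clamped_prev)
  qed
  show ?thesis
    unfolding eq by (simp add: mult.commute add_divide_distrib diff_divide_distrib)
qed

text \<open>\<open>- A_mat N\<close> is the Laplacian of the path graph on the nodes, so its
  quadratic form is the sum of the squared jumps between neighbours.\<close>

lemma A_negative_semidefinite:
  fixes f :: "nat \<Rightarrow> real"
  assumes "N \<ge> 1"
  shows "(\<Sum>i<N + 1. f i * (\<Sum>j<N + 1. A_mat N $$ (i, j) * f j)) \<le> 0"
proof -
  \<comment> \<open>The diagonal term is split in two, so that each neighbour is paired with one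
    copy of \<open>f i * f i\<close>.\<close>
  have "(\<Sum>i<N + 1. f i * (\<Sum>j<N + 1. A_mat N $$ (i, j) * f j)) =
      (\<Sum>i<N + 1. f i * f (min N (i + 1)) - f i * f i + (f i * f (i - 1) - f i * f i))"
    using assms by (intro sum.cong refl, subst A_mat_apply) (auto simp: algebra_simps)
  also have "\<dots> = (\<Sum>i<N. f i * f (i + 1)) + f N * f N - (\<Sum>i<N + 1. f i * f i)
      + (f 0 * f 0 + (\<Sum>i<N. f (i + 1) * f i) - (\<Sum>i<N + 1. f i * f i))"
    by (simp only: sum.distrib sum_subtractf sum_clamped_next sum_clamped_prev)
  also have "\<dots> = (\<Sum>i<N. f i * f (i + 1)) - (\<Sum>i<N. f i * f i)
      + ((\<Sum>i<N. f (i + 1) * f i) - (\<Sum>i<N. f (i + 1) * f (i + 1)))"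
  proof -
    \<comment> \<open>Each copy of the sum of squares loses a different end node: the one cancelled
      by the clamped neighbour it is paired with.\<close>
    have "(\<Sum>i<N + 1. f i * f i) = f 0 * f 0 + (\<Sum>i<N. f (i + 1) * f (i + 1))"
      by (simp add: sum.lessThan_Suc_shift del: sum.lessThan_Suc)
    moreover have "(\<Sum>i<N + 1. f i * f i) = (\<Sum>i<N. f i * f i) + f N * f N" by simp
    ultimately show ?thesis by linarith
  qed
  also have "\<dots> = - (\<Sum>i<N. (f (i + 1) - f i)\<^sup>2)"
    by (simp add: power2_eq_square algebra_simps sum.distrib sum_subtractf sum_negf sum_distrib_left)
  finally show ?thesis
    by (simp add: sum_nonneg)
qed

section \<open>Trace, determinant and signs of the eigenvalues\<close>

context
  fixes g H U :: real
  assumes g: "g > 0" and H: "H > 0"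
begin

text \<open>This is the trace of W M / (g H), which has diagonal U/H, U/g and off-diagonal entries
  1; \<open>lambda_prod\<close> is its determinant. The explicit roots enter later only through
  these two values and their signs.\<close>

lemma lambda_sum: "lambda1 g H U + lambda2 g H U = U / g + U / H"
  using g H by (simp add: lambda1_def lambda2_def field_simps)

lemma lambda_prod:
  assumes "U\<^sup>2 < g * H"
  shows "lambda1 g H U * lambda2 g H U = U\<^sup>2 / (g * H) - 1"
proof -
  let ?D = "U\<^sup>2 * (g + H)\<^sup>2 + 4 * g * H * (g * H - U\<^sup>2)"
  \<comment> \<open>With a nonnegative radicand the root squares back to it, so the product of the
    two conjugate numerators is free of roots.\<close>
  have "?D \<ge> 0" using g H assms by simp
  then have sq: "sqrt ?D * sqrt ?D = ?D" by simp
  have num: "(U * (g + H))\<^sup>2 - sqrt ?D * sqrt ?D = 4 * g * H * (U\<^sup>2 - g * H)"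
    unfolding sq by (simp add: power2_eq_square algebra_simps)
  have "lambda1 g H U * lambda2 g H U =
      ((U * (g + H))\<^sup>2 - sqrt ?D * sqrt ?D) / (2 * g * H)\<^sup>2"
    unfolding lambda1_def lambda2_def
    by (simp add: square_diff_square_factored power2_eq_square del: real_sqrt_mult_self)
  also have "\<dots> = (4 * g * H * (U\<^sup>2 - g * H)) / (2 * g * H)\<^sup>2"
    unfolding num ..
  also have "\<dots> = (U\<^sup>2 - g * H) / (g * H)"
    using g H by (simp add: power2_eq_square)
  finally show ?thesis
    using g H by (simp add: diff_divide_distrib)
qed

text \<open>The product of the eigenvalues is negative in sub-critical flow, so their signs differ;
  the order of the two roots decides which is positive.\<close>

lemma lambda_signs:
  assumes "U\<^sup>2 < g * H"
  shows "lambda1 g H U > 0" "lambda2 g H U < 0"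
proof -
  have "lambda1 g H U * lambda2 g H U < 0"
    using lambda_prod[OF assms] assms g H by simp
  moreover have "lambda1 g H U \<ge> lambda2 g H U"
    using g H assms unfolding lambda1_def lambda2_def
    by (intro mult_left_mono) auto
  ultimately show "lambda1 g H U > 0" "lambda2 g H U < 0"
    by (auto simp: mult_less_0_iff)
qed

text \<open>This is the orthogonality of the two columns of \<open>S\<close>.\<close>

lemma lambda_orthogonal:
  assumes "U\<^sup>2 < g * H"
  shows "(lambda1 g H U - U / g) * (lambda2 g H U - U / g) = - 1"
proof -
  have "(lambda1 g H U - U / g) * (lambda2 g H U - U / g) =
      lambda1 g H U * lambda2 g H U - U / g * (lambda1 g H U + lambda2 g H U) + (U / g)\<^sup>2"
    by (simp add: power2_eq_square algebra_simps)
  then show ?thesis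
    unfolding lambda_prod[OF assms] lambda_sum using g H
    by (simp add: power2_eq_square field_simps)
qed

end

section \<open>Characteristic variables and the boundary form\<close>

lemma S_mat_carrier [simp]: "S_mat g H U \<in> carrier_mat 2 2"
  by (simp add: S_mat_def mat_of_rows_list_def Let_def numeral_2_eq_2)

lemma W_mat_carrier [simp]: "W_mat g H \<in> carrier_mat 2 2"
  by (simp add: W_mat_def mat_of_rows_list_def numeral_2_eq_2)

lemma w_eq:
  shows "w1 g H U N q i =
      S_mat g H U $$ (0, 0) * q $ i + S_mat g H U $$ (1, 0) * q $ (N + 1 + i)"
    and "w2 g H U N q i =
      S_mat g H U $$ (0, 1) * q $ i + S_mat g H U $$ (1, 1) * q $ (N + 1 + i)"
  using carrier_matD[OF S_mat_carrier[of g H U]]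
  by (auto simp: w1_def w2_def cell_avg_def scalar_prod_def numeral_2_eq_2 vec_of_list_index)

text \<open>The spectral decomposition of W M, evaluated on one cell average. Up to normalisation
  the columns of S are (a, 1) and (b, 1), so the claim reduces to a polynomial identity modulo
  \<open>a * b = - 1\<close>.\<close>

lemma boundary_form_diagonal:
  assumes g: "g > 0" and H: "H > 0" and sub: "U\<^sup>2 < g * H"
  shows "g * U * (q $ i)\<^sup>2 + 2 * g * H * (q $ i) * (q $ (N + 1 + i)) + H * U * (q $ (N + 1 + i))\<^sup>2
    = g * H * (lambda1 g H U * (w1 g H U N q i)\<^sup>2 + lambda2 g H U * (w2 g H U N q i)\<^sup>2)"
proof -
  define a where "a = lambda1 g H U - U / g"
  define b where "b = lambda2 g H U - U / g"
  define h where "h = q $ i"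
  define u where "u = q $ (N + 1 + i)"
  have ab: "a * b = - 1"
    unfolding a_def b_def by (rule lambda_orthogonal[OF g H sub])
  have apb: "a + b = U / H - U / g"
    using lambda_sum[OF g H, of U] unfolding a_def b_def by simp
  have a0: "a \<noteq> 0" using ab by auto
  have b: "b = - 1 / a" using ab a0 by (simp add: field_simps)
  have pos: "a\<^sup>2 + 1 > 0" "b\<^sup>2 + 1 > 0" by (simp_all add: add_nonneg_pos)
  have nz: "a\<^sup>2 + 1 \<noteq> 0" using pos(1) by linarith
  have s: "S_mat g H U $$ (0, 0) = a / sqrt (a\<^sup>2 + 1)" "S_mat g H U $$ (1, 0) = 1 / sqrt (a\<^sup>2 + 1)"
      "S_mat g H U $$ (0, 1) = b / sqrt (b\<^sup>2 + 1)" "S_mat g H U $$ (1, 1) = 1 / sqrt (b\<^sup>2 + 1)"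
    by (simp_all add: S_mat_def mat_of_rows_list_def a_def b_def Let_def)
  have "w1 g H U N q i = (a * h + u) / sqrt (a\<^sup>2 + 1)" "w2 g H U N q i = (b * h + u) / sqrt (b\<^sup>2 + 1)"
    unfolding w_eq s h_def u_def by (simp_all add: add_divide_distrib)
  then have w: "(w1 g H U N q i)\<^sup>2 = (a * h + u)\<^sup>2 / (a\<^sup>2 + 1)"
      "(w2 g H U N q i)\<^sup>2 = (b * h + u)\<^sup>2 / (b\<^sup>2 + 1)"
    using pos by (simp_all add: power_divide)
  \<comment> \<open>As \<open>b = - 1 / a\<close>, the second column of S is, up to sign, (-1, a)
    normalised. Both squares thus get the same denominator.\<close>
  have w2': "(b * h + u)\<^sup>2 / (b\<^sup>2 + 1) = (a * u - h)\<^sup>2 / (a\<^sup>2 + 1)"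
  proof -
    have "b * h + u = (a * u - h) / a" "b\<^sup>2 + 1 = (a\<^sup>2 + 1) / a\<^sup>2"
      using a0 by (simp_all add: b field_simps power2_eq_square)
    then show ?thesis using a0 by (simp add: power_divide)
  qed
  \<comment> \<open>The parameter \<open>k\<close> becomes U/g, which turns \<open>a + k\<close> and
    \<open>b + k\<close> into the eigenvalues and \<open>a + b + k\<close> into U/H.\<close>
  have "(a + k) * (a * h + u)\<^sup>2 + (b + k) * (a * u - h)\<^sup>2
      = (a\<^sup>2 + 1) * ((a + b + k) * h\<^sup>2 + 2 * h * u + k * u\<^sup>2)" for k
  proof -
    \<comment> \<open>The difference of the two sides is a multiple of \<open>a * b + 1\<close>,
      which vanishes by orthogonality.\<close>
    have "(a + k) * (a * h + u)\<^sup>2 + (b + k) * (a * u - h)\<^sup>2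
        - (a\<^sup>2 + 1) * ((a + b + k) * h\<^sup>2 + 2 * h * u + k * u\<^sup>2)
        = (a * b + 1) * (a * u\<^sup>2 - a * h\<^sup>2 - 2 * h * u)"
      by (simp add: power2_eq_square algebra_simps)
    then show ?thesis using ab by simp
  qed
  then have "(a + k) * ((a * h + u)\<^sup>2 / (a\<^sup>2 + 1)) + (b + k) * ((a * u - h)\<^sup>2 / (a\<^sup>2 + 1))
      = (a + b + k) * h\<^sup>2 + 2 * h * u + k * u\<^sup>2" for k
    unfolding times_divide_eq_right add_divide_distrib[symmetric]
    by (simp only: nonzero_mult_div_cancel_left[OF nz])
  from this[of "U / g"] have "lambda1 g H U * (w1 g H U N q i)\<^sup>2 + lambda2 g H U * (w2 g H U N q i)\<^sup>2
      = U / H * h\<^sup>2 + 2 * h * u + U / g * u\<^sup>2"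
    unfolding w w2' apb by (simp add: a_def b_def)
  then show ?thesis
    using g H unfolding h_def[symmetric] u_def[symmetric] by (simp add: field_simps)
qed

section \<open>The penalty term\<close>

lemma W_mat_inverse:
  assumes "g > 0" "H > 0"
  shows "the (mat_inverse (W_mat g H)) = mat_of_rows_list 2 [[1 / g, 0], [0, 1 / H]]"
proof -
  let ?V = "mat_of_rows_list 2 [[1 / g, 0], [0, 1 / H]] :: real mat"
  have V: "?V \<in> carrier_mat 2 2" by (simp add: mat_of_rows_list_def numeral_2_eq_2)
  have WV: "W_mat g H * ?V = 1\<^sub>m 2" and VW: "?V * W_mat g H = 1\<^sub>m 2"
    using assms
    by (auto intro!: eq_matI simp: W_mat_def mat_of_rows_list_def scalar_prod_def
        numeral_2_eq_2 less_Suc_eq)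
  \<comment> \<open>Invertibility rules out the result \<open>None\<close>. The matrix returned is
    then identified by uniqueness of inverses: B = B (W V) = (B W) V = V.\<close>
  have "W_mat g H \<in> Units (ring_mat TYPE(real) 2 ())"
    unfolding Units_def ring_mat_def using V WV VW by auto
  then obtain B where B: "mat_inverse (W_mat g H) = Some B"
    using mat_inverse(1)[OF W_mat_carrier, where b = "()"] by (cases "mat_inverse (W_mat g H)") auto
  then have BW: "B * W_mat g H = 1\<^sub>m 2" "B \<in> carrier_mat 2 2"
    using mat_inverse(2)[OF W_mat_carrier] by auto
  have "B = B * (W_mat g H * ?V)" using BW(2) WV by simp
  also have "\<dots> = B * W_mat g H * ?V"
    using BW(2) V by (simp add: assoc_mult_mat[of _ 2 2 _ 2 _ 2])
  also have "\<dots> = ?V" using BW V by simp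
  finally show ?thesis using B by simp
qed

text \<open>At a node the penalty vector is (H X, g Y), and W maps this to g H (X, Y). Multiplying
  by W therefore also cancels the leading inverse, leaving -(g H / 2) S (X, Y).\<close>

lemma SAT_row:
  fixes b0 bN \<gamma>0 \<gamma>1 \<tau>01 \<tau>02 \<tau>N1 \<tau>N2 U :: real and q :: "real vec"
  assumes g: "g > 0" and H: "H > 0" and N: "N \<ge> 1" and i: "i < N + 1"
    and b0: "b0 = w1 g H U N q 0 - \<gamma>0 * w2 g H U N q 0"
    and bN: "bN = w2 g H U N q N - \<gamma>1 * w1 g H U N q N"
  defines "Z \<equiv> SAT g H U N \<gamma>0 \<gamma>1 \<tau>01 \<tau>02 \<tau>N1 \<tau>N2 q" and "S \<equiv> S_mat g H U"
  defines "X \<equiv> of_bool (i = 0) * (\<tau>01 * b0) + of_bool (i = N) * (\<tau>N1 * bN)"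
    and "Y \<equiv> of_bool (i = 0) * (\<tau>02 * b0) + of_bool (i = N) * (\<tau>N2 * bN)"
  shows "g * Z $ i = - (g * H) / 2 * (S $$ (0, 0) * X + S $$ (0, 1) * Y)"
    and "H * Z $ (N + 1 + i) = - (g * H) / 2 * (S $$ (1, 0) * X + S $$ (1, 1) * Y)"
proof -
  define K where "K = the (mat_inverse (W_mat g H)) * S_mat g H U * W_mat g H"
  define e0 :: "real vec" where "e0 = unit_vec (N + 1) 0"
  define eN :: "real vec" where "eN = unit_vec (N + 1) N"
  define v where "v = ((\<tau>01 * H * b0) \<cdot>\<^sub>v e0 + (\<tau>N1 * H * bN) \<cdot>\<^sub>v eN) @\<^sub>v
              ((\<tau>02 * g * b0) \<cdot>\<^sub>v e0 + (\<tau>N2 * g * bN) \<cdot>\<^sub>v eN)"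
  have S: "S \<in> carrier_mat 2 2" by (simp add: S_def)
  have K: "K \<in> carrier_mat 2 2" "K $$ (0, 0) = S $$ (0, 0)" "K $$ (0, 1) = S $$ (0, 1) * H / g"
      "K $$ (1, 0) = S $$ (1, 0) * g / H" "K $$ (1, 1) = S $$ (1, 1)"
    unfolding K_def W_mat_inverse[OF g H] S_def[symmetric] using g H carrier_matD[OF S]
    by (auto simp: W_mat_def mat_of_rows_list_def scalar_prod_def numeral_2_eq_2)
  have v: "v \<in> carrier_vec (2 * (N + 1))"
    unfolding v_def e0_def eN_def mult_2 by (intro append_carrier_vec add_carrier_vec) auto
  have vi: "v $ j = H * (of_bool (j = 0) * (\<tau>01 * b0) + of_bool (j = N) * (\<tau>N1 * bN))"
      "v $ (N + 1 + j) = g * (of_bool (j = 0) * (\<tau>02 * b0) + of_bool (j = N) * (\<tau>N2 * bN))"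
    if "j < N + 1" for j
    using that by (auto simp: v_def e0_def eN_def algebra_simps)
  have one: "(\<Sum>j<N + 1. 1\<^sub>m (N + 1) $$ (i, j) * f j) = f i" for f :: "nat \<Rightarrow> real"
  proof -
    have "(\<Sum>j<N + 1. 1\<^sub>m (N + 1) $$ (i, j) * f j) = (\<Sum>j<N + 1. of_bool (j = i) * f j)"
      using i by (intro sum.cong) auto
    then show ?thesis using sum_of_bool_mult[OF i] by simp
  qed
  have Z: "Z = (- 1 / 2) \<cdot>\<^sub>v (kron K (1\<^sub>m (N + 1)) *\<^sub>v v)"
    by (simp add: Z_def SAT_def Let_def K_def v_def e0_def eN_def b0 bN)
  have dim: "dim_vec (kron K (1\<^sub>m (N + 1)) *\<^sub>v v) = 2 * (N + 1)"
    using K(1) by simp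
  have Zj: "Z $ j = - 1 / 2 * (kron K (1\<^sub>m (N + 1)) *\<^sub>v v) $ j" if "j < 2 * (N + 1)" for j
    unfolding Z using that dim by simp
  have Z0: "Z $ i = - 1 / 2 * (K $$ (0, 0) * v $ i + K $$ (0, 1) * v $ (N + 1 + i))"
    using i by (subst Zj) (simp_all only: kron_2_mult_vec_index[OF K(1) one_carrier_mat v i] one, simp)
  show "g * Z $ i = - (g * H) / 2 * (S $$ (0, 0) * X + S $$ (0, 1) * Y)"
    using g unfolding Z0 vi[OF i] K X_def[symmetric] Y_def[symmetric] by (simp add: field_simps)
  have Z1: "Z $ (N + 1 + i) = - 1 / 2 * (K $$ (1, 0) * v $ i + K $$ (1, 1) * v $ (N + 1 + i))"
    using i by (subst Zj) (simp_all only: kron_2_mult_vec_index[OF K(1) one_carrier_mat v i] one, simp)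
  show "H * Z $ (N + 1 + i) = - (g * H) / 2 * (S $$ (1, 0) * X + S $$ (1, 1) * Y)"
    using H unfolding Z1 vi[OF i] K X_def[symmetric] Y_def[symmetric] by (simp add: field_simps)
qed

text \<open>Pairing a cell average with S (X, Y) is the same as pairing its characteristic variables
  with (X, Y), because these variables are obtained by applying the transpose of S.\<close>

lemma SAT_energy:
  fixes \<gamma>0 \<gamma>1 \<tau>01 \<tau>02 \<tau>N1 \<tau>N2 U :: real and q :: "real vec"
  assumes g: "g > 0" and H: "H > 0" and N: "N \<ge> 1"
  defines "Z \<equiv> SAT g H U N \<gamma>0 \<gamma>1 \<tau>01 \<tau>02 \<tau>N1 \<tau>N2 q"
    and "w1' \<equiv> w1 g H U N q" and "w2' \<equiv> w2 g H U N q"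
  shows "(\<Sum>i<N + 1. q $ i * (g * Z $ i) + q $ (N + 1 + i) * (H * Z $ (N + 1 + i))) =
    - (g * H) / 2 * ((w1' 0 - \<gamma>0 * w2' 0) * (\<tau>01 * w1' 0 + \<tau>02 * w2' 0)
      + (w2' N - \<gamma>1 * w1' N) * (\<tau>N1 * w1' N + \<tau>N2 * w2' N))"
proof -
  define b0 where "b0 = w1' 0 - \<gamma>0 * w2' 0"
  define bN where "bN = w2' N - \<gamma>1 * w1' N"
  note row = SAT_row[OF g H N _ b0_def[unfolded w1'_def w2'_def] bN_def[unfolded w1'_def w2'_def]]
  \<comment> \<open>The characteristic variables stay at the running node \<open>i\<close>, so that
    the identity holds term by term; the indicators pick the end nodes afterwards.\<close>
  have "(\<Sum>i<N + 1. q $ i * (g * Z $ i) + q $ (N + 1 + i) * (H * Z $ (N + 1 + i))) =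
      (\<Sum>i<N + 1. - (g * H) / 2 * (of_bool (i = 0) * (b0 * (\<tau>01 * w1' i + \<tau>02 * w2' i))
        + of_bool (i = N) * (bN * (\<tau>N1 * w1' i + \<tau>N2 * w2' i))))"
  proof (rule sum.cong[OF refl])
    fix i assume "i \<in> {..<N + 1}"
    then have i: "i < N + 1" by simp
    show "q $ i * (g * Z $ i) + q $ (N + 1 + i) * (H * Z $ (N + 1 + i)) =
        - (g * H) / 2 * (of_bool (i = 0) * (b0 * (\<tau>01 * w1' i + \<tau>02 * w2' i))
        + of_bool (i = N) * (bN * (\<tau>N1 * w1' i + \<tau>N2 * w2' i)))"
      unfolding Z_def row[OF i] w1'_def w2'_def w_eq by (simp add: field_simps)
  qed
  also have "\<dots> = - (g * H) / 2 * (b0 * (\<tau>01 * w1' 0 + \<tau>02 * w2' 0) + bN * (\<tau>N1 * w1' N + \<tau>N2 * w2' N))"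
    by (simp only: sum_distrib_left[symmetric] sum.distrib
        sum_of_bool_mult[OF zero_less_Suc, unfolded Suc_eq_plus1]
        sum_of_bool_mult[OF lessI, unfolded Suc_eq_plus1])
  finally show ?thesis unfolding b0_def bN_def .
qed

section \<open>Mass matrix and discrete norm\<close>

lemma P_mat_apply:
  assumes "i < N + 1"
  shows "(\<Sum>j<N + 1. P_mat N x $$ (i, j) * v j) = cell_length N x i * v i"
proof -
  have "(\<Sum>j<N + 1. P_mat N x $$ (i, j) * v j) = (\<Sum>j<N + 1. of_bool (j = i) * (cell_length N x j * v j))"
    using assms by (intro sum.cong) (auto simp: P_mat_def mat_diag_def)
  then show ?thesis by (simp only: sum_of_bool_mult[OF assms])
qed

lemma operator_carriers:
  "P_mat N x \<in> carrier_mat (N + 1) (N + 1)" "Q_mat N \<in> carrier_mat (N + 1) (N + 1)"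
  "A_mat N \<in> carrier_mat (N + 1) (N + 1)" "M_mat g H U \<in> carrier_mat 2 2"
  by (auto simp: P_mat_def mat_diag_def Q_mat_def A_mat_def M_mat_def mat_of_rows_list_def numeral_2_eq_2)

lemma sum_lessThan_add:
  fixes f :: "nat \<Rightarrow> 'a::comm_monoid_add"
  shows "(\<Sum>k<m + n. f k) = (\<Sum>k<m. f k) + (\<Sum>k<n. f (m + k))"
  by (induction n) (simp_all add: add.assoc)

text \<open>A finite sum of scalar functions can be differentiated with the entrywise notion of
  derivative.\<close>

lemma WP_norm_sq_eq:
  assumes q: "q \<in> carrier_vec (2 * (N + 1))"
  shows "WP_norm_sq g H N x q =
    (\<Sum>i<N + 1. cell_length N x i * (g * (q $ i)\<^sup>2 + H * (q $ (N + 1 + i))\<^sup>2))"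
proof -
  define y where "y = kron (W_mat g H) (P_mat N x) *\<^sub>v q"
  have y: "y $ i = g * (cell_length N x i * q $ i)"
      "y $ (N + 1 + i) = H * (cell_length N x i * q $ (N + 1 + i))" if i: "i < N + 1" for i
    unfolding y_def kron_2_mult_vec_index[OF W_mat_carrier operator_carriers(1) q i] P_mat_apply[OF i]
    by (simp_all add: W_mat_def mat_of_rows_list_def)
  have "dim_vec y = 2 * (N + 1)"
    by (simp add: y_def kron_def W_mat_def P_mat_def mat_diag_def mat_of_rows_list_def)
  then have "WP_norm_sq g H N x q = (\<Sum>k<2 * (N + 1). q $ k * y $ k)"
    by (simp add: WP_norm_sq_def scalar_prod_def y_def[symmetric] atLeast0LessThan)
  also have "\<dots> = (\<Sum>i<N + 1. q $ i * y $ i) + (\<Sum>i<N + 1. q $ (N + 1 + i) * y $ (N + 1 + i))"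
    by (simp only: mult_2 sum_lessThan_add)
  also have "\<dots> = (\<Sum>i<N + 1. cell_length N x i * (g * (q $ i)\<^sup>2 + H * (q $ (N + 1 + i))\<^sup>2))"
    unfolding sum.distrib[symmetric]
    by (rule sum.cong[OF refl]) (simp only: lessThan_iff y power2_eq_square, simp add: algebra_simps)
  finally show ?thesis .
qed

text \<open>The right boundary is the instance with \<open>l1 = - \<lambda>\<^sub>2\<close> and \<open>l2 = - \<lambda>\<^sub>1\<close>.\<close>

lemma boundary_energy:
  fixes l1 l2 \<gamma> a b :: real
  assumes "l1 > 0" "\<gamma>\<^sup>2 \<le> - l2 / l1"
  shows "(l1 * a\<^sup>2 + l2 * b\<^sup>2) - (a - \<gamma> * b) * (l1 * a + \<gamma> * l1 * b) \<le> 0"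
proof -
  \<comment> \<open>The penalty product is a difference of squares,
    \<open>l1 * (a\<^sup>2 - \<gamma>\<^sup>2 * b\<^sup>2)\<close>: it removes \<open>a\<close>
    entirely and leaves this coefficient on \<open>b\<^sup>2\<close>.\<close>
  have "l2 + l1 * \<gamma>\<^sup>2 \<le> 0" using assms by (simp add: field_simps)
  then have "(l2 + l1 * \<gamma>\<^sup>2) * b\<^sup>2 \<le> 0" by (simp add: mult_nonpos_nonneg)
  then show ?thesis by (simp add: power2_eq_square algebra_simps)
qed

section \<open>Assembly of the energy estimate\<close>

theorem theorem9:
  fixes g H U \<alpha> \<gamma>0 \<gamma>1 \<tau>01 \<tau>02 \<tau>N1 \<tau>N2 :: real
    and N :: nat
    and x :: "nat \<Rightarrow> real"
    and q :: "real \<Rightarrow> real vec"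
  assumes "g > 0" and "H > 0" and "U^2 < g * H"
    and "\<alpha> \<ge> 0"
    and "\<gamma>0^2 \<le> - lambda2 g H U / lambda1 g H U"
    and "\<gamma>1^2 \<le> - lambda1 g H U / lambda2 g H U"
    and "N \<ge> 1" and "is_grid N x"
    and "\<tau>01 = lambda1 g H U"
    and "\<tau>02 = \<gamma>0 * lambda1 g H U"
    and "\<tau>N2 = - lambda2 g H U"
    and "\<tau>N1 = - \<gamma>1 * lambda2 g H U"
    and "is_solution g H U \<alpha> N x \<gamma>0 \<gamma>1 \<tau>01 \<tau>02 \<tau>N1 \<tau>N2 q"
  shows "\<forall>t\<ge>0. \<exists>D. ((\<lambda>s. WP_norm_sq g H N x (q s)) has_real_derivative D) (at t within {0..})
           \<and> 1/2 * D \<le> 0"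
proof (intro allI impI)
  fix t :: real
  assume t: "t \<ge> 0"
  note g = assms(1) and H = assms(2) and sub = assms(3) and \<alpha> = assms(4) and N = assms(7)
  note sol = assms(13)[unfolded is_solution_def, rule_format]
  define l1 where "l1 = lambda1 g H U"
  define l2 where "l2 = lambda2 g H U"
  have l1: "l1 > 0" and l2: "l2 < 0"
    using lambda_signs[OF g H sub] by (simp_all add: l1_def l2_def)
  have qt: "q s \<in> carrier_vec (2 * (N + 1))" if "s \<ge> 0" for s
    using sol[OF that] by simp
  obtain dq where dq: "dq \<in> carrier_vec (2 * (N + 1))"
      and der: "has_vec_derivative q dq (at t within {0..})"
      and eq: "kron (1\<^sub>m 2) (P_mat N x) *\<^sub>v dq + kron (M_mat g H U) (Q_mat N) *\<^sub>v q t
            - (\<alpha> / 2) \<cdot>\<^sub>v (kron (1\<^sub>m 2) (A_mat N) *\<^sub>v q t)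
          = SAT g H U N \<gamma>0 \<gamma>1 \<tau>01 \<tau>02 \<tau>N1 \<tau>N2 (q t)"
    using sol[OF t] by blast
  define Z where "Z = SAT g H U N \<gamma>0 \<gamma>1 \<tau>01 \<tau>02 \<tau>N1 \<tau>N2 (q t)"
  define P where "P = cell_length N x"
  define h where "h i = q t $ i" for i
  define u where "u i = q t $ (N + 1 + i)" for i
  define dh where "dh i = dq $ i" for i
  define du where "du i = dq $ (N + 1 + i)" for i
  define Q where "Q f i = (\<Sum>j<N + 1. Q_mat N $$ (i, j) * f j)" for f :: "nat \<Rightarrow> real" and i
  define A where "A f i = (\<Sum>j<N + 1. A_mat N $$ (i, j) * f j)" for f :: "nat \<Rightarrow> real" and i
  define I where "I f v = (\<Sum>i<N + 1. f i * v i)" for f v :: "nat \<Rightarrow> real"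
  define D where "D = (\<Sum>i<N + 1. P i * (g * (2 * h i * dh i) + H * (2 * u i * du i)))"

  \<comment> \<open>The nodal formula for the norm is available only for \<open>s \<ge> 0\<close>,
    where the dimension of \<open>q s\<close> is known. This suffices for the derivative within
    \<open>{0..}\<close>; the radius 1 is arbitrary.\<close>
  have deriv: "((\<lambda>s. WP_norm_sq g H N x (q s)) has_real_derivative D) (at t within {0..})"
  proof (rule has_field_derivative_transform_within[where d = 1])
    have comp: "((\<lambda>s. q s $ k) has_real_derivative dq $ k) (at t within {0..})"
      if "k < 2 * (N + 1)" for k
      using der dq that unfolding has_vec_derivative_def by auto
    show "((\<lambda>s. \<Sum>i<N + 1. P i * (g * (q s $ i)\<^sup>2 + H * (q s $ (N + 1 + i))\<^sup>2))
        has_real_derivative D) (at t within {0..})"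
      unfolding D_def
    proof (rule DERIV_sum)
      fix i assume i: "i \<in> {..<N + 1}"
      then have "i < 2 * (N + 1)" "N + 1 + i < 2 * (N + 1)" by auto
      note c = this[THEN comp]
      show "((\<lambda>s. P i * (g * (q s $ i)\<^sup>2 + H * (q s $ (N + 1 + i))\<^sup>2))
          has_real_derivative P i * (g * (2 * h i * dh i) + H * (2 * u i * du i))) (at t within {0..})"
        unfolding h_def u_def dh_def du_def
        by (rule derivative_eq_intros c refl)+ simp
    qed
  qed (use t in \<open>simp_all only: WP_norm_sq_eq[OF qt] P_def atLeast_iff zero_less_one\<close>)

  \<comment> \<open>The scheme is solved for the mass-weighted derivatives, the combinations that
    occur in \<open>D\<close>.\<close>
  have row: "P i * dh i = \<alpha> / 2 * A h i - U * Q h i - H * Q u i + Z $ i"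
      "P i * du i = \<alpha> / 2 * A u i - g * Q h i - U * Q u i + Z $ (N + 1 + i)"
    if i: "i < N + 1" for i
  proof -
    note k = kron_2_mult_vec_index[OF one_carrier_mat operator_carriers(1) dq i]
      kron_2_mult_vec_index[OF one_carrier_mat operator_carriers(3) qt[OF t] i]
      kron_2_mult_vec_index[OF operator_carriers(4) operator_carriers(2) qt[OF t] i, of g H U]
    have comp: "Z $ j = (kron (1\<^sub>m 2) (P_mat N x) *\<^sub>v dq) $ j
        + (kron (M_mat g H U) (Q_mat N) *\<^sub>v q t) $ j
        - \<alpha> / 2 * (kron (1\<^sub>m 2) (A_mat N) *\<^sub>v q t) $ j" if "j < 2 * (N + 1)" for j
      unfolding Z_def eq[symmetric] using that operator_carriers[THEN carrier_matD(1)]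
      by (simp del: index_mult_mat_vec)
    have M: "M_mat g H U $$ (0, 0) = U" "M_mat g H U $$ (0, 1) = H"
        "M_mat g H U $$ (1, 0) = g" "M_mat g H U $$ (1, 1) = U"
      by (simp_all add: M_mat_def mat_of_rows_list_def)
    have one: "(1\<^sub>m 2 :: real mat) $$ (0, 0) = 1" "(1\<^sub>m 2 :: real mat) $$ (0, 1) = 0"
        "(1\<^sub>m 2 :: real mat) $$ (1, 0) = 0" "(1\<^sub>m 2 :: real mat) $$ (1, 1) = 1"
      by simp_all
    have "i < 2 * (N + 1)" "N + 1 + i < 2 * (N + 1)" using i by auto
    note c = this[THEN comp, unfolded k M one P_mat_apply[OF i],
        folded h_def u_def dh_def du_def, folded Q_def A_def P_def]
    show "P i * dh i = \<alpha> / 2 * A h i - U * Q h i - H * Q u i + Z $ i"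
        "P i * du i = \<alpha> / 2 * A u i - g * Q h i - U * Q u i + Z $ (N + 1 + i)"
      using c by (simp_all only:) simp_all
  qed

  define E where "E = (\<Sum>i<N + 1. h i * (g * Z $ i) + u i * (H * Z $ (N + 1 + i)))"
  have "1/2 * D = (\<Sum>i<N + 1. g * h i * (P i * dh i) + H * u i * (P i * du i))"
    unfolding D_def sum_distrib_left by (rule sum.cong) (simp_all add: algebra_simps)
  \<comment> \<open>Weighting by W makes both off-diagonal flux coefficients equal to g H. The mixed
    terms thus combine into the symmetric sum that summation by parts needs.\<close>
  also have "\<dots> = (\<Sum>i<N + 1.
      \<alpha> / 2 * (g * (h i * A h i) + H * (u i * A u i)) - g * U * (h i * Q h i) - H * U * (u i * Q u i)
      - g * H * (h i * Q u i + u i * Q h i) + (h i * (g * Z $ i) + u i * (H * Z $ (N + 1 + i))))"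
  proof (rule sum.cong[OF refl])
    fix i assume "i \<in> {..<N + 1}"
    then have i: "i < N + 1" by simp
    show "g * h i * (P i * dh i) + H * u i * (P i * du i) =
      \<alpha> / 2 * (g * (h i * A h i) + H * (u i * A u i)) - g * U * (h i * Q h i) - H * U * (u i * Q u i)
      - g * H * (h i * Q u i + u i * Q h i) + (h i * (g * Z $ i) + u i * (H * Z $ (N + 1 + i)))"
      unfolding row[OF i] by (simp add: algebra_simps)
  qed
  also have "\<dots> = \<alpha> / 2 * (g * I h (A h) + H * I u (A u)) - g * U * I h (Q h) - H * U * I u (Q u)
      - g * H * (I h (Q u) + I u (Q h)) + E"
    unfolding E_def I_def by (simp only: sum.distrib sum_subtractf sum_distrib_left[symmetric])
  also have "\<dots> \<le> - g * U * I h (Q h) - H * U * I u (Q u) - g * H * (I h (Q u) + I u (Q h)) + E"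
  proof -
    have "I f (A f) \<le> 0" for f
      using A_negative_semidefinite[OF N, of f] unfolding I_def A_def .
    then have "g * I h (A h) + H * I u (A u) \<le> 0"
      using g H by (simp add: add_nonpos_nonpos mult_nonneg_nonpos)
    then have "\<alpha> / 2 * (g * I h (A h) + H * I u (A u)) \<le> 0"
      using \<alpha> by (intro mult_nonneg_nonpos) auto
    then show ?thesis by simp
  qed
  also have "\<dots> = (g * U * (h 0)\<^sup>2 + 2 * g * H * h 0 * u 0 + H * U * (u 0)\<^sup>2) / 2
      - (g * U * (h N)\<^sup>2 + 2 * g * H * h N * u N + H * U * (u N)\<^sup>2) / 2 + E"
  proof -
    have sbp: "I f (Q v) + I v (Q f) = f N * v N - f 0 * v 0" for f v
      using Q_summation_by_parts[OF N, of f v] unfolding I_def Q_def .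
    have I: "I h (Q h) = ((h N)\<^sup>2 - (h 0)\<^sup>2) / 2" "I u (Q u) = ((u N)\<^sup>2 - (u 0)\<^sup>2) / 2"
      using sbp[of h h] sbp[of u u] by (simp_all add: power2_eq_square)
    then show ?thesis
      unfolding sbp[of h u] I by (simp add: field_simps)
  qed
  \<comment> \<open>The terms are grouped by end node to fit \<open>boundary_energy\<close>. On the
    right the boundary form enters with a minus sign, so the eigenvalues are negated and
    \<open>w2\<close> takes the role of the ingoing variable.\<close>
  also have "\<dots> = g * H / 2 *
      ((l1 * (w1 g H U N (q t) 0)\<^sup>2 + l2 * (w2 g H U N (q t) 0)\<^sup>2
        - (w1 g H U N (q t) 0 - \<gamma>0 * w2 g H U N (q t) 0)
          * (l1 * w1 g H U N (q t) 0 + \<gamma>0 * l1 * w2 g H U N (q t) 0))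
      + (- l2 * (w2 g H U N (q t) N)\<^sup>2 + - l1 * (w1 g H U N (q t) N)\<^sup>2
        - (w2 g H U N (q t) N - \<gamma>1 * w1 g H U N (q t) N)
          * (- l2 * w2 g H U N (q t) N + \<gamma>1 * - l2 * w1 g H U N (q t) N)))"
    unfolding E_def Z_def h_def u_def SAT_energy[OF g H N] boundary_form_diagonal[OF g H sub]
      assms(9-12) l1_def[symmetric] l2_def[symmetric]
    by (simp add: field_simps)
  also have "\<dots> \<le> 0"
  proof (intro mult_nonneg_nonpos add_nonpos_nonpos boundary_energy)
    show "\<gamma>1\<^sup>2 \<le> - (- l1) / - l2"
      using assms(6) by (simp add: l1_def l2_def)
  qed (use g H l1 l2 assms(5) in \<open>auto simp: l1_def l2_def\<close>)
  finally show "\<exists>D. ((\<lambda>s. WP_norm_sq g H N x (q s)) has_real_derivative D) (at t within {0..})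
           \<and> 1/2 * D \<le> 0"
    using deriv by blast
qed

end
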